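(* Let $u,v\in\ell^+$. The inequality \[ \sup_n\Big|\Big(\frac1n\sum_{k=1}^nx_k\Big)-x_n\Big|v_n\le A\sup_k\frac{|x_k|}{u_k} \] holds for all real sequences $x$ with $A=A(C-I)$; for all nonnegative sequences $x$ with $A=A^+(C-I)$; for all nonnegative, nonincreasing sequences $x$ with $A=A^\downarrow(C-I)$; and for all nonnegative, nondecreasing sequences $x$ with $A=A^\uparrow(I-C)$. In each case the constant $A$ is best possible. Here \begin{align*} A(C-I)&=\||C-I|u\|_{\ell^\infty(v)}=\sup_n\frac{v_n}n\Big((n-1)u_n+\sum_{k=1}^{n-1}u_k\Big);\\ A^+(C-I)&=\max(\|(C-I)^+u\|_{\ell^\infty(v)},\|(C-I)^-u\|_{\ell^\infty(v)})=\sup_n\frac{v_n}n\max\Big((n-1)u_n,\sum_{k=1}^{n-1}u_k\Big);\\ A^\downarrow(C-I)&=\|(C-I)^+(u^\downarrow)\|_{\ell^\infty(v)}=\sup_n\frac{v_n}n\sum_{k=1}^{n-1}\min_{j\le k}u_j;\\ A^\uparrow(I-C)&=\|(I-C)^+(u^\uparrow)\|_{\ell^\infty(v)}=\sup_n\frac{v_n}n(n-1)\inf_{j\ge n}u_j. \end{align*}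
   Context: All sequences are indexed by the positive integers, and $\ell^+$ is the set of nonnegative real sequences. $C$ is the Cesàro matrix, the lower triangular matrix with entries $1/n$ in row $n$, columns $k\le n$; $I$ is the identity matrix. For a real matrix $B=(b_{n,k})$, $|B|=(|b_{n,k}|)$, $B^+=((|b_{n,k}|+b_{n,k})/2)$, $B^-=((|b_{n,k}|-b_{n,k})/2)$, and $(Bx)_n=\sum_k b_{n,k}x_k$. $\|y\|_{\ell^\infty(v)}=\sup_n|y_n|v_n$; $u^\downarrow_k=\min_{j\le k}u_j$, $u^\uparrow_k=\inf_{j\ge k}u_j$. Empty sums are $0$. If $u_k=0$, then $|x_k|/u_k$ is $0$ when $x_k=0$ and $\infty$ when $x_k\ne0$. Suprema may take the value $\infty$. Best possible means that $A$ is the smallest constant in $[0,\infty]$ for which the inequality holds for all sequences of the stated kind. Some expressions need to be understood according to the convention $\infty\cdot0=0$. *)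

theory Defs
  imports "HOL-Analysis.Analysis"
begin

text \<open>
  Sequences and matrices are indexed by the positive integers: they are functions on \<open>nat\<close> of which
  only the values at indices \<open>\<ge> 1\<close> are used. Quantities in \<open>[0,\<infinity>]\<close> live in
  \<^typ>\<open>ennreal\<close>, where \<open>\<infinity> * 0 = 0\<close>.
\<close>

definition nonneg_seqs :: "(nat \<Rightarrow> real) set" where
  "nonneg_seqs = {x. \<forall>k\<ge>1. 0 \<le> x k}"

definition nonneg_decreasing_seqs :: "(nat \<Rightarrow> real) set" where
  "nonneg_decreasing_seqs = {x \<in> nonneg_seqs. antimono_on {1..} x}"

definition nonneg_increasing_seqs :: "(nat \<Rightarrow> real) set" where
  "nonneg_increasing_seqs = {x \<in> nonneg_seqs. mono_on {1..} x}"


type_synonym inf_matrix = "nat \<Rightarrow> nat \<Rightarrow> real"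

definition cesaro :: inf_matrix where
  "cesaro n k = (if 1 \<le> k \<and> k \<le> n then 1 / real n else 0)"

definition ident :: inf_matrix where
  "ident n k = (if n = k then 1 else 0)"

definition mat_abs :: "inf_matrix \<Rightarrow> inf_matrix" where
  "mat_abs B n k = \<bar>B n k\<bar>"

definition mat_pos :: "inf_matrix \<Rightarrow> inf_matrix" where
  "mat_pos B n k = (\<bar>B n k\<bar> + B n k) / 2"

definition mat_neg :: "inf_matrix \<Rightarrow> inf_matrix" where
  "mat_neg B n k = (\<bar>B n k\<bar> - B n k) / 2"

definition mat_app :: "inf_matrix \<Rightarrow> (nat \<Rightarrow> real) \<Rightarrow> nat \<Rightarrow> real" where
  "mat_app B x n = (\<Sum>\<^sub>\<infinity>k\<in>{1..}. B n k * x k)"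


definition linf_norm :: "(nat \<Rightarrow> real) \<Rightarrow> (nat \<Rightarrow> real) \<Rightarrow> ennreal" where
  "linf_norm v y = (SUP n\<in>{1..}. ennreal (\<bar>y n\<bar> * v n))"

definition seq_down :: "(nat \<Rightarrow> real) \<Rightarrow> nat \<Rightarrow> real" where
  "seq_down u k = Min (u ` {1..k})"

definition seq_up :: "(nat \<Rightarrow> real) \<Rightarrow> nat \<Rightarrow> real" where
  "seq_up u k = Inf (u ` {k..})"


text \<open>
  Division in \<^typ>\<open>ennreal\<close> agrees with the convention that \<open>|x k| / u k\<close>
  is \<open>0\<close> or \<open>\<infinity>\<close> when \<open>u k = 0\<close>, according to whether \<open>x k = 0\<close>.
\<close>

definition ratio_sup :: "(nat \<Rightarrow> real) \<Rightarrow> (nat \<Rightarrow> real) \<Rightarrow> ennreal" where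
  "ratio_sup u x = (SUP k\<in>{1..}. ennreal \<bar>x k\<bar> / ennreal (u k))"

lemma ratio_conv:
  fixes x u :: real
  assumes "0 \<le> u"
  shows "ennreal \<bar>x\<bar> / ennreal u =
    (if u = 0 then (if x = 0 then 0 else \<infinity>) else ennreal (\<bar>x\<bar> / u))"
  using assms by (auto simp: divide_ennreal ennreal_divide_zero)

text \<open>
  The inequality says nothing about sequences with \<^term>\<open>ratio_sup u x = \<infinity>\<close>, for any
  constant \<open>A\<close> including \<open>A = 0\<close>. Reading \<open>0 * \<infinity> = 0\<close> here would leave no
  best constant: for \<open>u k = 1 / k\<close> and \<open>v = 1\<close>, every nonzero nondecreasing \<open>x \<ge> 0\<close>
  has infinite ratio, and the constant \<open>0\<close> would fail while every \<open>A > 0\<close> works.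
\<close>

definition rhs :: "ennreal \<Rightarrow> (nat \<Rightarrow> real) \<Rightarrow> (nat \<Rightarrow> real) \<Rightarrow> ennreal" where
  "rhs A u x = (if ratio_sup u x = \<infinity> then \<infinity> else A * ratio_sup u x)"

definition cesaro_diff_ineq ::
    "(nat \<Rightarrow> real) \<Rightarrow> (nat \<Rightarrow> real) \<Rightarrow> ennreal \<Rightarrow> (nat \<Rightarrow> real) \<Rightarrow> bool" where
  "cesaro_diff_ineq u v A x \<longleftrightarrow>
    (SUP n\<in>{1..}. ennreal (\<bar>1 / real n * (\<Sum>k=1..n. x k) - x n\<bar> * v n)) \<le> rhs A u x"

definition best_constant ::
    "(nat \<Rightarrow> real) \<Rightarrow> (nat \<Rightarrow> real) \<Rightarrow> (nat \<Rightarrow> real) set \<Rightarrow> ennreal \<Rightarrow> bool" where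
  "best_constant u v X A \<longleftrightarrow>
    (\<forall>x\<in>X. cesaro_diff_ineq u v A x) \<and>
    (\<forall>A'. (\<forall>x\<in>X. cesaro_diff_ineq u v A' x) \<longrightarrow> A \<le> A')"

end

theory Submission
  imports Defs
begin

text \<open>
  Row \<open>n\<close> of \<open>C - I\<close> sends \<open>x\<close> to \<open>1/n\<close> times the deviation
  \<open>d = (\<Sum>k<n. x k) - (n - 1) x n\<close>. Homogeneity reduces each inequality to finding, separately for every
  \<open>n\<close>, the maximum \<open>g n\<close> of \<open>\<bar>d\<bar>\<close> over those \<open>x\<close> of the given kind with \<open>\<bar>x k\<bar> \<le> u k\<close>. The maximum
  is attained in every case, so the best constant is the supremum of \<open>v n / n * g n\<close>; this is
  \<open>best_constant_if_extremal\<close>, and it leaves four finite-dimensional extremal problems.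

  For arbitrary \<open>x\<close> all terms of \<open>d\<close> can be given the same sign. For \<open>x \<ge> 0\<close> the two parts of \<open>d\<close> have opposite
  signs, and one of them is best switched off. For nonincreasing \<open>x\<close> one has \<open>d \<ge> 0\<close>, and
  \<open>x \<le> u\<close> is the same as \<open>x \<le> u\<down>\<close>, so the extremal \<open>x\<close> is \<open>u\<down>\<close> cut off at \<open>n\<close>. For
  nondecreasing \<open>x\<close> one has \<open>d \<le> 0\<close>, and \<open>x n \<le> u\<up> n\<close>, so the extremal \<open>x\<close> is a step of height
  \<open>u\<up> n\<close> starting at \<open>n\<close>.
\<close>

section \<open>Reduction to an extremal problem in each row\<close>

definition row_deviation :: "(nat \<Rightarrow> real) \<Rightarrow> nat \<Rightarrow> real" where
  "row_deviation x n = (\<Sum>k=1..n-1. x k) - (real n - 1) * x n"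

lemma sum_split_last:
  fixes f :: "nat \<Rightarrow> real"
  assumes "1 \<le> n"
  shows "(\<Sum>k=1..n. f k) = (\<Sum>k=1..n-1. f k) + f n"
  using assms by (cases n) auto

lemma cesaro_minus_eq_row_deviation:
  assumes "1 \<le> n"
  shows "1 / real n * (\<Sum>k=1..n. x k) - x n = row_deviation x n / real n"
  unfolding sum_split_last[OF assms] row_deviation_def using assms by (simp add: field_simps)

lemma cesaro_minus_abs_eq:
  assumes "1 \<le> n"
  shows "\<bar>1 / real n * (\<Sum>k=1..n. x k) - x n\<bar> * v n = v n / real n * \<bar>row_deviation x n\<bar>"
  unfolding cesaro_minus_eq_row_deviation[OF assms] by (simp add: abs_divide)

text \<open>
  The case \<open>u k = 0\<close> relies on the ratio being infinite there unless \<open>x k = 0\<close>.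
\<close>

lemma abs_le_if_ratio_sup_eq:
  assumes "u \<in> nonneg_seqs" and "ratio_sup u x = ennreal r" and "0 \<le> r" and "1 \<le> k"
  shows "\<bar>x k\<bar> \<le> r * u k"
proof -
  have u: "0 \<le> u k"
    using assms by (simp add: nonneg_seqs_def)
  have le: "ennreal \<bar>x k\<bar> / ennreal (u k) \<le> ennreal r"
    unfolding assms(2)[symmetric] ratio_sup_def using assms(4) by (intro SUP_upper) simp
  show ?thesis
  proof (cases "u k = 0")
    case True
    then show ?thesis
      using le by (cases "x k = 0") (auto simp: ratio_conv top_unique)
  next
    case False
    with u have "\<bar>x k\<bar> / u k \<le> r"
      using le assms(3) by (simp add: ratio_conv)
    then show ?thesis
      using False u by (simp add: field_simps)
  qed
qed

lemma ratio_sup_le_one: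
  assumes "u \<in> nonneg_seqs" and "\<And>k. 1 \<le> k \<Longrightarrow> \<bar>x k\<bar> \<le> u k"
  shows "ratio_sup u x \<le> 1"
  unfolding ratio_sup_def
proof (rule SUP_least)
  fix k :: nat
  assume "k \<in> {1..}"
  then have u: "0 \<le> u k" and x: "\<bar>x k\<bar> \<le> u k"
    using assms by (auto simp: nonneg_seqs_def)
  show "ennreal \<bar>x k\<bar> / ennreal (u k) \<le> 1"
  proof (cases "u k = 0")
    case True
    then show ?thesis using x by simp
  next
    case False
    then show ?thesis using u x by (simp add: ratio_conv)
  qed
qed

text \<open>
  The extremal sequence may depend on the row: testing the inequality with constant \<open>A'\<close> on the extremal
  sequence of row \<open>n\<close> and keeping only the \<open>n\<close>-th term on the left gives \<open>v n / n * g n \<le> A'\<close>.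
\<close>

lemma best_constant_if_extremal:
  assumes u: "u \<in> nonneg_seqs" and v: "v \<in> nonneg_seqs"
    and bound: "\<And>x r n. \<lbrakk>x \<in> X; 0 \<le> r; \<And>k. 1 \<le> k \<Longrightarrow> \<bar>x k\<bar> \<le> r * u k; 1 \<le> n\<rbrakk>
      \<Longrightarrow> \<bar>row_deviation x n\<bar> \<le> r * g n"
    and attained: "\<And>n. 1 \<le> n
      \<Longrightarrow> \<exists>x\<in>X. (\<forall>k\<ge>1. \<bar>x k\<bar> \<le> u k) \<and> g n \<le> \<bar>row_deviation x n\<bar>"
  shows "best_constant u v X (SUP n\<in>{1..}. ennreal (v n / real n * g n))"
    (is "best_constant u v X ?A")
  unfolding best_constant_def
proof (intro conjI ballI allI impI)
  fix x
  assume x: "x \<in> X"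
  show "cesaro_diff_ineq u v ?A x"
  proof (cases "ratio_sup u x = \<infinity>")
    case True
    then show ?thesis by (simp add: cesaro_diff_ineq_def rhs_def)
  next
    case False
    then obtain r where r: "0 \<le> r" "ratio_sup u x = ennreal r"
      by (cases "ratio_sup u x") auto
    show ?thesis
      unfolding cesaro_diff_ineq_def
    proof (rule SUP_least)
      fix n :: nat
      assume "n \<in> {1..}"
      then have n: "1 \<le> n" by simp
      have vn: "0 \<le> v n / real n"
        using v n by (simp add: nonneg_seqs_def)
      have "\<bar>row_deviation x n\<bar> \<le> r * g n"
        using abs_le_if_ratio_sup_eq[OF u r(2,1)] by (intro bound x r n)
      then have "v n / real n * \<bar>row_deviation x n\<bar> \<le> v n / real n * (r * g n)"
        using vn by (rule mult_left_mono)
      also have "\<dots> = (v n / real n * g n) * r" by simp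
      finally have "ennreal (v n / real n * \<bar>row_deviation x n\<bar>)
          \<le> ennreal (v n / real n * g n) * ennreal r"
        using r(1) by (simp add: ennreal_mult''[symmetric] ennreal_leI)
      also have "\<dots> \<le> ?A * ennreal r"
        using n by (intro mult_right_mono SUP_upper) auto
      also have "\<dots> = rhs ?A u x"
        using r by (simp add: rhs_def)
      finally show "ennreal (\<bar>1 / real n * (\<Sum>k=1..n. x k) - x n\<bar> * v n) \<le> rhs ?A u x"
        by (simp only: cesaro_minus_abs_eq[OF n])
    qed
  qed
next
  fix A'
  assume A': "\<forall>x\<in>X. cesaro_diff_ineq u v A' x"
  show "?A \<le> A'"
  proof (rule SUP_least)
    fix n :: nat
    assume "n \<in> {1..}"
    then have n: "1 \<le> n" by simp
    then obtain x where x: "x \<in> X" "\<And>k. 1 \<le> k \<Longrightarrow> \<bar>x k\<bar> \<le> u k" "g n \<le> \<bar>row_deviation x n\<bar>"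
      using attained by blast
    have ratio: "ratio_sup u x \<le> 1"
      by (rule ratio_sup_le_one[OF u x(2)])
    have "0 \<le> v n / real n"
      using v n by (simp add: nonneg_seqs_def)
    then have "ennreal (v n / real n * g n) \<le> ennreal (v n / real n * \<bar>row_deviation x n\<bar>)"
      using x(3) by (intro ennreal_leI mult_left_mono)
    also have "\<dots> = ennreal (\<bar>1 / real n * (\<Sum>k=1..n. x k) - x n\<bar> * v n)"
      by (simp only: cesaro_minus_abs_eq[OF n])
    also have "\<dots> \<le> (SUP n\<in>{1..}. ennreal (\<bar>1 / real n * (\<Sum>k=1..n. x k) - x n\<bar> * v n))"
      using n by (intro SUP_upper) simp
    also have "\<dots> \<le> rhs A' u x"
      using A' x(1) by (simp add: cesaro_diff_ineq_def)
    also have "\<dots> = A' * ratio_sup u x"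
      using ratio by (auto simp: rhs_def top_unique)
    also have "\<dots> \<le> A' * 1"
      using ratio by (rule mult_left_mono) simp
    finally show "ennreal (v n / real n * g n) \<le> A'" by simp
  qed
qed

section \<open>The four extremal problems\<close>

lemma sum_upto_pred_const:
  fixes c :: real
  assumes "1 \<le> n"
  shows "(\<Sum>k=1..n-1. c) = (real n - 1) * c"
  using assms by (simp add: of_nat_diff)

lemma best_constant_all:
  assumes u: "u \<in> nonneg_seqs" and v: "v \<in> nonneg_seqs"
  shows "best_constant u v UNIV
    (SUP n\<in>{1..}. ennreal (v n / real n * ((real n - 1) * u n + (\<Sum>k=1..n-1. u k))))"
proof (rule best_constant_if_extremal[OF u v])
  fix x :: "nat \<Rightarrow> real" and r :: real and n :: nat
  assume x: "\<And>k. 1 \<le> k \<Longrightarrow> \<bar>x k\<bar> \<le> r * u k" and n: "1 \<le> n"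
  have "\<bar>\<Sum>k=1..n-1. x k\<bar> \<le> (\<Sum>k=1..n-1. r * u k)"
    by (rule order_trans[OF sum_abs]) (auto intro!: sum_mono x)
  moreover have "\<bar>(real n - 1) * x n\<bar> \<le> (real n - 1) * (r * u n)"
    using n x[OF n] by (simp add: abs_mult mult_left_mono)
  ultimately show "\<bar>row_deviation x n\<bar> \<le> r * ((real n - 1) * u n + (\<Sum>k=1..n-1. u k))"
    unfolding row_deviation_def sum_distrib_left[symmetric] by (simp add: algebra_simps)
next
  fix n :: nat
  assume n: "1 \<le> n"
  let ?x = "\<lambda>k. if k < n then u k else - u k"
  have "(\<Sum>k=1..n-1. ?x k) = (\<Sum>k=1..n-1. u k)"
    by (rule sum.cong) auto
  then have "row_deviation ?x n = (real n - 1) * u n + (\<Sum>k=1..n-1. u k)"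
    by (simp add: row_deviation_def)
  moreover have "\<forall>k\<ge>1. \<bar>?x k\<bar> \<le> u k"
    using u by (simp add: nonneg_seqs_def)
  ultimately show "\<exists>x\<in>UNIV. (\<forall>k\<ge>1. \<bar>x k\<bar> \<le> u k)
      \<and> (real n - 1) * u n + (\<Sum>k=1..n-1. u k) \<le> \<bar>row_deviation x n\<bar>"
    by (intro bexI[of _ ?x]) auto
qed

lemma best_constant_nonneg:
  assumes u: "u \<in> nonneg_seqs" and v: "v \<in> nonneg_seqs"
  shows "best_constant u v nonneg_seqs
    (SUP n\<in>{1..}. ennreal (v n / real n * max ((real n - 1) * u n) (\<Sum>k=1..n-1. u k)))"
proof (rule best_constant_if_extremal[OF u v])
  fix x :: "nat \<Rightarrow> real" and r :: real and n :: nat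
  assume x0: "x \<in> nonneg_seqs" and r: "0 \<le> r" and x: "\<And>k. 1 \<le> k \<Longrightarrow> \<bar>x k\<bar> \<le> r * u k"
    and n: "1 \<le> n"
  have x_bounds: "0 \<le> x k \<and> x k \<le> r * u k" if "1 \<le> k" for k
    using x0 x[OF that] that by (auto simp: nonneg_seqs_def)
  have "0 \<le> (\<Sum>k=1..n-1. x k)"
    using x_bounds by (intro sum_nonneg) auto
  moreover have "(\<Sum>k=1..n-1. x k) \<le> r * (\<Sum>k=1..n-1. u k)"
    unfolding sum_distrib_left using x_bounds by (intro sum_mono) auto
  moreover have "0 \<le> (real n - 1) * x n"
    using x_bounds[OF n] n by simp
  moreover have "(real n - 1) * x n \<le> (real n - 1) * (r * u n)"
    using x_bounds[OF n] n by (intro mult_left_mono) auto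
  ultimately have "\<bar>row_deviation x n\<bar>
      \<le> max (r * ((real n - 1) * u n)) (r * (\<Sum>k=1..n-1. u k))"
    unfolding row_deviation_def by (simp add: mult.left_commute)
  then show "\<bar>row_deviation x n\<bar> \<le> r * max ((real n - 1) * u n) (\<Sum>k=1..n-1. u k)"
    using r by (simp add: max_mult_distrib_left)
next
  fix n :: nat
  assume n: "1 \<le> n"
  let ?g = "max ((real n - 1) * u n) (\<Sum>k=1..n-1. u k)"
  let ?before = "\<lambda>k. if k < n then u k else 0" and ?from = "\<lambda>k. if k < n then 0 else u k"
  have "(\<Sum>k=1..n-1. ?before k) = (\<Sum>k=1..n-1. u k)"
    by (rule sum.cong) auto
  then have before: "row_deviation ?before n = (\<Sum>k=1..n-1. u k)"
    by (simp add: row_deviation_def)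
  have "(\<Sum>k=1..n-1. ?from k) = 0"
    by (rule sum.neutral) auto
  then have "from": "row_deviation ?from n = - ((real n - 1) * u n)"
    by (simp add: row_deviation_def)
  have mem: "?before \<in> nonneg_seqs" "?from \<in> nonneg_seqs"
    and le: "\<forall>k\<ge>1. \<bar>?before k\<bar> \<le> u k" "\<forall>k\<ge>1. \<bar>?from k\<bar> \<le> u k"
    using u by (auto simp: nonneg_seqs_def)
  show "\<exists>x\<in>nonneg_seqs. (\<forall>k\<ge>1. \<bar>x k\<bar> \<le> u k) \<and> ?g \<le> \<bar>row_deviation x n\<bar>"
  proof (cases "(real n - 1) * u n \<le> (\<Sum>k=1..n-1. u k)")
    case True
    then have "?g \<le> \<bar>row_deviation ?before n\<bar>"
      unfolding before by simp
    with mem(1) le(1) show ?thesis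
      by (intro bexI[of _ ?before] conjI)
  next
    case False
    then have "?g \<le> \<bar>row_deviation ?from n\<bar>"
      unfolding "from" by simp
    with mem(2) le(2) show ?thesis
      by (intro bexI[of _ ?from] conjI)
  qed
qed

lemma seq_down_le:
  assumes "1 \<le> j" and "j \<le> k"
  shows "seq_down u k \<le> u j"
  unfolding seq_down_def using assms by (intro Min_le) auto

lemma le_seq_down:
  assumes "1 \<le> k" and "\<And>j. \<lbrakk>1 \<le> j; j \<le> k\<rbrakk> \<Longrightarrow> c \<le> u j"
  shows "c \<le> seq_down u k"
  unfolding seq_down_def using assms by (subst Min_ge_iff) auto

lemma seq_down_nonneg:
  assumes "u \<in> nonneg_seqs" and "1 \<le> k"
  shows "0 \<le> seq_down u k"
  using assms by (intro le_seq_down) (auto simp: nonneg_seqs_def)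

lemma seq_up_le:
  assumes "u \<in> nonneg_seqs" and "1 \<le> k" and "k \<le> j"
  shows "seq_up u k \<le> u j"
proof -
  have "bdd_below (u ` {k..})"
    using assms(1,2) by (intro bdd_belowI[of _ 0]) (auto simp: nonneg_seqs_def)
  then show ?thesis
    unfolding seq_up_def using assms(3) by (intro cInf_lower) auto
qed

lemma le_seq_up:
  assumes "\<And>j. k \<le> j \<Longrightarrow> c \<le> u j"
  shows "c \<le> seq_up u k"
  unfolding seq_up_def using assms by (intro cInf_greatest) auto

lemma seq_up_nonneg:
  assumes "u \<in> nonneg_seqs" and "1 \<le> k"
  shows "0 \<le> seq_up u k"
  using assms by (intro le_seq_up) (auto simp: nonneg_seqs_def)

lemma best_constant_decreasing:
  assumes u: "u \<in> nonneg_seqs" and v: "v \<in> nonneg_seqs"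
  shows "best_constant u v nonneg_decreasing_seqs
    (SUP n\<in>{1..}. ennreal (v n / real n * (\<Sum>k=1..n-1. seq_down u k)))"
proof (rule best_constant_if_extremal[OF u v])
  fix x :: "nat \<Rightarrow> real" and r :: real and n :: nat
  assume x_mem: "x \<in> nonneg_decreasing_seqs" and r: "0 \<le> r"
    and x: "\<And>k. 1 \<le> k \<Longrightarrow> \<bar>x k\<bar> \<le> r * u k" and n: "1 \<le> n"
  have nonneg: "0 \<le> x k" if "1 \<le> k" for k
    using x_mem that by (auto simp: nonneg_decreasing_seqs_def nonneg_seqs_def)
  have anti: "x k \<le> x j" if "1 \<le> j" "j \<le> k" for j k
    using x_mem that by (auto simp: nonneg_decreasing_seqs_def monotone_on_def)
  \<comment> \<open>The minimum is some \<open>u j\<close> with \<open>j \<le> k\<close>, and \<open>x k \<le> x j\<close>.\<close>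
  have le_down: "x k \<le> r * seq_down u k" if k: "1 \<le> k" for k
  proof -
    have "seq_down u k \<in> u ` {1..k}"
      unfolding seq_down_def using k by (intro Min_in) auto
    then obtain j where j: "1 \<le> j" "j \<le> k" "seq_down u k = u j" by auto
    then show ?thesis
      using anti[OF j(1,2)] x[OF j(1)] by simp
  qed
  have "(real n - 1) * x n \<le> (\<Sum>k=1..n-1. x k)"
    unfolding sum_upto_pred_const[OF n, symmetric] by (intro sum_mono anti) auto
  moreover have "0 \<le> (real n - 1) * x n"
    using nonneg[OF n] n by simp
  moreover have "(\<Sum>k=1..n-1. x k) \<le> r * (\<Sum>k=1..n-1. seq_down u k)"
    unfolding sum_distrib_left by (intro sum_mono le_down) auto
  ultimately show "\<bar>row_deviation x n\<bar> \<le> r * (\<Sum>k=1..n-1. seq_down u k)"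
    unfolding row_deviation_def by simp
next
  fix n :: nat
  assume n: "1 \<le> n"
  let ?x = "\<lambda>k. if k < n then seq_down u k else 0"
  have "(\<Sum>k=1..n-1. ?x k) = (\<Sum>k=1..n-1. seq_down u k)"
    by (rule sum.cong) auto
  then have dev: "row_deviation ?x n = (\<Sum>k=1..n-1. seq_down u k)"
    by (simp add: row_deviation_def)
  have "seq_down u k \<le> seq_down u j" if "1 \<le> j" "j \<le> k" for j k
    using that by (intro le_seq_down seq_down_le) auto
  then have "antimono_on {1..} ?x"
    using seq_down_nonneg[OF u] by (auto simp: monotone_on_def)
  then have "?x \<in> nonneg_decreasing_seqs"
    using seq_down_nonneg[OF u] by (auto simp: nonneg_decreasing_seqs_def nonneg_seqs_def)
  moreover have "\<forall>k\<ge>1. \<bar>?x k\<bar> \<le> u k"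
    using seq_down_nonneg[OF u] seq_down_le[of _ _ u] u by (auto simp: nonneg_seqs_def)
  ultimately show "\<exists>x\<in>nonneg_decreasing_seqs. (\<forall>k\<ge>1. \<bar>x k\<bar> \<le> u k)
      \<and> (\<Sum>k=1..n-1. seq_down u k) \<le> \<bar>row_deviation x n\<bar>"
    using dev by (intro bexI[of _ ?x]) auto
qed

lemma best_constant_increasing:
  assumes u: "u \<in> nonneg_seqs" and v: "v \<in> nonneg_seqs"
  shows "best_constant u v nonneg_increasing_seqs
    (SUP n\<in>{1..}. ennreal (v n / real n * ((real n - 1) * seq_up u n)))"
proof (rule best_constant_if_extremal[OF u v])
  fix x :: "nat \<Rightarrow> real" and r :: real and n :: nat
  assume x_mem: "x \<in> nonneg_increasing_seqs" and r: "0 \<le> r"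
    and x: "\<And>k. 1 \<le> k \<Longrightarrow> \<bar>x k\<bar> \<le> r * u k" and n: "1 \<le> n"
  have nonneg: "0 \<le> x k" if "1 \<le> k" for k
    using x_mem that by (auto simp: nonneg_increasing_seqs_def nonneg_seqs_def)
  have mono: "x j \<le> x k" if "1 \<le> j" "j \<le> k" for j k
    using x_mem that by (auto simp: nonneg_increasing_seqs_def monotone_on_def)
  \<comment> \<open>Monotonicity gives \<open>x n \<le> x j \<le> r * u j\<close> for all \<open>j \<ge> n\<close>; dividing by \<open>r\<close> makes \<open>x n / r\<close>
    a lower bound in the infimum that defines \<open>u\<up> n\<close>.\<close>
  have le_up: "x n \<le> r * seq_up u n"
  proof (cases "r = 0")
    case True
    then show ?thesis using x[OF n] by simp
  next
    case False
    with r have r: "0 < r" by simp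
    have "x n / r \<le> seq_up u n"
    proof (rule le_seq_up)
      fix j
      assume j: "n \<le> j"
      with n have "x n \<le> r * u j"
        using mono[OF n j] x[of j] by simp
      then show "x n / r \<le> u j"
        using r by (simp add: field_simps)
    qed
    then show ?thesis
      using r by (simp add: field_simps)
  qed
  have "(\<Sum>k=1..n-1. x k) \<le> (real n - 1) * x n"
    unfolding sum_upto_pred_const[OF n, symmetric] by (intro sum_mono mono) auto
  moreover have "0 \<le> (\<Sum>k=1..n-1. x k)"
    by (intro sum_nonneg nonneg) auto
  moreover have "(real n - 1) * x n \<le> (real n - 1) * (r * seq_up u n)"
    using le_up n by (intro mult_left_mono) auto
  ultimately show "\<bar>row_deviation x n\<bar> \<le> r * ((real n - 1) * seq_up u n)"
    unfolding row_deviation_def by (simp add: mult.left_commute)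
next
  fix n :: nat
  assume n: "1 \<le> n"
  let ?x = "\<lambda>k. if k < n then 0 else seq_up u n"
  have up: "0 \<le> seq_up u n"
    by (rule seq_up_nonneg[OF u n])
  have "(\<Sum>k=1..n-1. ?x k) = 0"
    by (rule sum.neutral) auto
  then have dev: "row_deviation ?x n = - ((real n - 1) * seq_up u n)"
    by (simp add: row_deviation_def)
  have "?x \<in> nonneg_increasing_seqs"
    using up by (auto simp: nonneg_increasing_seqs_def nonneg_seqs_def monotone_on_def)
  moreover have "\<forall>k\<ge>1. \<bar>?x k\<bar> \<le> u k"
    using up seq_up_le[OF u n] u by (auto simp: nonneg_seqs_def)
  moreover have "(real n - 1) * seq_up u n \<le> \<bar>row_deviation ?x n\<bar>"
    unfolding dev by simp
  ultimately show "\<exists>x\<in>nonneg_increasing_seqs. (\<forall>k\<ge>1. \<bar>x k\<bar> \<le> u k)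
      \<and> (real n - 1) * seq_up u n \<le> \<bar>row_deviation x n\<bar>"
    by (intro bexI[of _ ?x] conjI)
qed

section \<open>The matrix norms\<close>

lemma mat_app_lower_triangular:
  assumes n: "1 \<le> n" and zero: "\<And>k. n < k \<Longrightarrow> B n k = 0"
  shows "mat_app B x n = (\<Sum>k=1..n-1. B n k * x k) + B n n * x n"
proof -
  have "mat_app B x n = (\<Sum>\<^sub>\<infinity>k\<in>{1..n}. B n k * x k)"
    unfolding mat_app_def by (rule infsum_cong_neutral) (auto simp: zero)
  also have "\<dots> = (\<Sum>k=1..n. B n k * x k)"
    by (rule infsum_finite) simp
  finally show ?thesis
    by (simp only: sum_split_last[OF n])
qed

text \<open>
  Row \<open>n\<close> of \<open>C - I\<close> is \<open>1/n\<close> left of the diagonal and \<open>1/n - 1 \<le> 0\<close> on it. Its absolute value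
  and its positive and negative parts are therefore again constant left of the diagonal.
\<close>

lemma mat_app_row_const:
  assumes n: "1 \<le> n" and zero: "\<And>k. n < k \<Longrightarrow> B n k = 0"
    and before: "\<And>k. \<lbrakk>1 \<le> k; k < n\<rbrakk> \<Longrightarrow> B n k = b"
  shows "mat_app B x n = b * (\<Sum>k=1..n-1. x k) + B n n * x n"
proof -
  have "(\<Sum>k=1..n-1. B n k * x k) = (\<Sum>k=1..n-1. b * x k)"
    by (rule sum.cong) (auto simp: before)
  then show ?thesis
    by (simp add: mat_app_lower_triangular[where B = B, OF n zero] sum_distrib_left)
qed

lemma mat_app_abs_cesaro_minus_ident:
  assumes "1 \<le> n"
  shows "mat_app (mat_abs (cesaro - ident)) x n
    = ((real n - 1) * x n + (\<Sum>k=1..n-1. x k)) / real n"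
  using assms
  by (subst mat_app_row_const[where b = "1 / real n"])
    (auto simp: mat_abs_def cesaro_def ident_def field_simps)

lemma mat_app_pos_cesaro_minus_ident:
  assumes "1 \<le> n"
  shows "mat_app (mat_pos (cesaro - ident)) x n = (\<Sum>k=1..n-1. x k) / real n"
  using assms
  by (subst mat_app_row_const[where b = "1 / real n"])
    (auto simp: mat_pos_def cesaro_def ident_def field_simps)

lemma mat_app_neg_cesaro_minus_ident:
  assumes "1 \<le> n"
  shows "mat_app (mat_neg (cesaro - ident)) x n = (real n - 1) * x n / real n"
  using assms
  by (subst mat_app_row_const[where b = 0])
    (auto simp: mat_neg_def cesaro_def ident_def field_simps)

lemma mat_app_pos_ident_minus_cesaro:
  assumes "1 \<le> n"
  shows "mat_app (mat_pos (ident - cesaro)) x n = (real n - 1) * x n / real n"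
  using assms
  by (subst mat_app_row_const[where b = 0])
    (auto simp: mat_pos_def cesaro_def ident_def field_simps)

lemma linf_norm_eq_SUP:
  assumes "\<And>n. 1 \<le> n \<Longrightarrow> y n = g n / real n" and "\<And>n. 1 \<le> n \<Longrightarrow> 0 \<le> g n"
  shows "linf_norm v y = (SUP n\<in>{1..}. ennreal (v n / real n * g n))"
  unfolding linf_norm_def using assms by (intro SUP_cong) (auto simp: mult.commute)

lemma max_SUP_ennreal_weighted:
  assumes "v \<in> nonneg_seqs"
  shows "max (SUP n\<in>{1..}. ennreal (v n / real n * f n)) (SUP n\<in>{1..}. ennreal (v n / real n * g n))
    = (SUP n\<in>{1..}. ennreal (v n / real n * max (g n) (f n)))"
proof -
  have "max (ennreal (v n / real n * f n)) (ennreal (v n / real n * g n))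
      = ennreal (v n / real n * max (g n) (f n))" if "n \<in> {1..}" for n
  proof -
    have weight: "0 \<le> v n / real n"
      using assms that by (simp add: nonneg_seqs_def)
    show ?thesis
    proof (cases "f n \<le> g n")
      case True
      then show ?thesis
        using ennreal_leI[OF mult_left_mono[OF True weight]] by (simp only: max_absorb1 max_absorb2)
    next
      case False
      then have le: "g n \<le> f n" by simp
      then show ?thesis
        using ennreal_leI[OF mult_left_mono[OF le weight]] by (simp only: max_absorb1 max_absorb2)
    qed
  qed
  then show ?thesis
    unfolding sup_max[where 'a = ennreal, symmetric]
      Complete_Lattices.SUP_sup_distrib
    by (intro SUP_cong refl)
qed

theorem corollary3p8:
  fixes u v :: "nat \<Rightarrow> real"
  assumes "u \<in> nonneg_seqs" and "v \<in> nonneg_seqs"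
  shows
    "(best_constant u v UNIV (linf_norm v (mat_app (mat_abs (cesaro - ident)) u)) \<and>
      linf_norm v (mat_app (mat_abs (cesaro - ident)) u) =
        (SUP n\<in>{1..}. ennreal (v n / real n * ((real n - 1) * u n + (\<Sum>k=1..n-1. u k))))) \<and>
     (best_constant u v nonneg_seqs
        (max (linf_norm v (mat_app (mat_pos (cesaro - ident)) u))
             (linf_norm v (mat_app (mat_neg (cesaro - ident)) u))) \<and>
      max (linf_norm v (mat_app (mat_pos (cesaro - ident)) u))
          (linf_norm v (mat_app (mat_neg (cesaro - ident)) u)) =
        (SUP n\<in>{1..}. ennreal (v n / real n * max ((real n - 1) * u n) (\<Sum>k=1..n-1. u k)))) \<and>
     (best_constant u v nonneg_decreasing_seqs
        (linf_norm v (mat_app (mat_pos (cesaro - ident)) (seq_down u))) \<and>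
      linf_norm v (mat_app (mat_pos (cesaro - ident)) (seq_down u)) =
        (SUP n\<in>{1..}. ennreal (v n / real n * (\<Sum>k=1..n-1. Min (u ` {1..k}))))) \<and>
     (best_constant u v nonneg_increasing_seqs
        (linf_norm v (mat_app (mat_pos (ident - cesaro)) (seq_up u))) \<and>
      linf_norm v (mat_app (mat_pos (ident - cesaro)) (seq_up u)) =
        (SUP n\<in>{1..}. ennreal (v n / real n * (real n - 1) * Inf (u ` {n..}))))"
proof -
  note u = assms(1) and v = assms(2)
  have sum_nonneg_upto: "0 \<le> (\<Sum>k=1..n-1. u k)" for n
    using u by (intro sum_nonneg) (auto simp: nonneg_seqs_def)
  have term_nonneg: "0 \<le> (real n - 1) * u n" if "1 \<le> n" for n
    using u that by (simp add: nonneg_seqs_def)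
  have abs_norm: "linf_norm v (mat_app (mat_abs (cesaro - ident)) u) =
      (SUP n\<in>{1..}. ennreal (v n / real n * ((real n - 1) * u n + (\<Sum>k=1..n-1. u k))))"
    by (intro linf_norm_eq_SUP mat_app_abs_cesaro_minus_ident add_nonneg_nonneg
        term_nonneg sum_nonneg_upto)
  have "linf_norm v (mat_app (mat_pos (cesaro - ident)) u) =
      (SUP n\<in>{1..}. ennreal (v n / real n * (\<Sum>k=1..n-1. u k)))"
    by (intro linf_norm_eq_SUP mat_app_pos_cesaro_minus_ident sum_nonneg_upto)
  moreover have "linf_norm v (mat_app (mat_neg (cesaro - ident)) u) =
      (SUP n\<in>{1..}. ennreal (v n / real n * ((real n - 1) * u n)))"
    by (intro linf_norm_eq_SUP mat_app_neg_cesaro_minus_ident term_nonneg)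
  ultimately have max_norm: "max (linf_norm v (mat_app (mat_pos (cesaro - ident)) u))
      (linf_norm v (mat_app (mat_neg (cesaro - ident)) u)) =
      (SUP n\<in>{1..}. ennreal (v n / real n * max ((real n - 1) * u n) (\<Sum>k=1..n-1. u k)))"
    by (simp only: max_SUP_ennreal_weighted[OF v])
  have down_norm: "linf_norm v (mat_app (mat_pos (cesaro - ident)) (seq_down u)) =
      (SUP n\<in>{1..}. ennreal (v n / real n * (\<Sum>k=1..n-1. seq_down u k)))"
    by (intro linf_norm_eq_SUP mat_app_pos_cesaro_minus_ident sum_nonneg seq_down_nonneg[OF u]) auto
  have up_norm: "linf_norm v (mat_app (mat_pos (ident - cesaro)) (seq_up u)) =
      (SUP n\<in>{1..}. ennreal (v n / real n * ((real n - 1) * seq_up u n)))"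
    using seq_up_nonneg[OF u]
    by (intro linf_norm_eq_SUP mat_app_pos_ident_minus_cesaro mult_nonneg_nonneg) auto
  show ?thesis
    unfolding abs_norm max_norm down_norm up_norm
    using best_constant_all[OF u v] best_constant_nonneg[OF u v]
      best_constant_decreasing[OF u v] best_constant_increasing[OF u v]
    by (simp add: seq_down_def seq_up_def mult.assoc)
qed

end
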